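(* The assignments $\mathbf S\mapsto\mathbb R(\mathbf S)$ (from sectionally residuated join-semilattices to relatively residuated join-semilattices) and $\mathbf R\mapsto\mathbb S(\mathbf R)$ (from relatively residuated join-semilattices to sectionally residuated join-semilattices) form a one-to-one correspondence, i.e. $\mathbb S\big(\mathbb R(\mathbf S)\big)=\mathbf S$ for every sectionally residuated join-semilattice $\mathbf S$, and $\mathbb R\big(\mathbb S(\mathbf R)\big)=\mathbf R$ for every relatively residuated join-semilattice $\mathbf R$.
   Context: In a join-semilattice $(S,\vee,1)$ with top element $1$, the order is $x\leq y$ iff $x\vee y=y$, and $[x,1]:=\{y\in S: x\leq y\}$. A sectionally residuated join-semilattice is a quintuple $(S,\vee,(\odot_x;x\in S),\rightarrow,1)$ such that $(S,\vee,1)$ is a join-semilattice with top element $1$, for each $x\in S$, $([x,1],\odot_x,1)$ is a commutative monoid, $\rightarrow$ is a binary operation on $S$, and for all $x,y,z,u\in S$: (a) if $z\leq u\leq x,y$ then $x\odot_zy=x\odot_uy$; (b) if $u\leq x,y,z$ and $x\leq y$ then $x\odot_uz\leq y\odot_uz$; (c) $(x\vee z)\odot_z(y\vee z)\leq z$ if and only if $x\vee z\leq y\rightarrow z$; (d) $(x\vee y)\rightarrow y=x\rightarrow y$. A relatively residuated join-semilattice is a partial algebra $(R,\vee,\odot,\rightarrow,1)$ of type $(2,2,2,0)$ where $\vee,\rightarrow$ are (total) binary operations, $x\odot y$ is defined if and only if $x$ and $y$ have a common lower bound, and in this case $z\leq x\odot y$ for all $z\in R$ with $z\leq x,y$, and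 for all $x,y,z\in R$: (10) $(R,\vee,1)$ is a join-semilattice with top element $1$; (11) $x\odot1=1\odot x=x$; (12) $x\odot y=y\odot x$ whenever $x$ and $y$ have a common lower bound; (13) $(x\odot y)\odot z=x\odot(y\odot z)$ whenever $x,y,z$ have a common lower bound; (14) $x\leq y$ implies $x\odot z\leq y\odot z$ whenever $x$ and $z$ have a common lower bound; (15) $(x\vee z)\odot(y\vee z)\leq z$ if and only if $x\vee z\leq y\rightarrow z$; (16) $(x\vee y)\rightarrow y=x\rightarrow y$. For a sectionally residuated join-semilattice $\mathbf S=(S,\vee,(\odot_x;x\in S),\rightarrow,1)$, $\mathbb R(\mathbf S):=(S,\vee,\odot,\rightarrow,1)$ where $x\odot y$ is defined iff $x,y$ have a common lower bound $z$, and then $x\odot y:=x\odot_zy$ (this does not depend on the choice of $z$). For a relatively residuated join-semilattice $\mathbf R=(R,\vee,\odot,\rightarrow,1)$, $\mathbb S(\mathbf R):=(R,\vee,(\odot_x;x\in R),\rightarrow,1)$ where $\odot_x$ is the restriction of $\odot$ to $[x,1]$. *)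

theory Defs
  imports "HOL-Algebra.Group"
begin

text \<open>The underlying set of an algebra is a whole type. A partial operation is a function into
  an \<^emph>\<open>option\<close> type with value \<^term>\<open>None\<close> exactly off its domain, so equality
  of records is equality of algebras: equal operations with equal domains.\<close>

no_notation Lattice.join (infixl "\<squnion>\<index>" 65)

record 'a imp_alg =
  vee :: "'a \<Rightarrow> 'a \<Rightarrow> 'a" (infixl "\<squnion>\<index>" 65)
  imp :: "'a \<Rightarrow> 'a \<Rightarrow> 'a" (infixr "\<rightarrow>\<index>" 60)
  unity :: 'a ("\<I>\<index>")

definition leq :: "('a, 'm) imp_alg_scheme \<Rightarrow> 'a \<Rightarrow> 'a \<Rightarrow> bool" (infix "\<preceq>\<index>" 50) where
  "x \<preceq>\<^bsub>A\<^esub> y \<longleftrightarrow> x \<squnion>\<^bsub>A\<^esub> y = y"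

definition up_section :: "('a, 'm) imp_alg_scheme \<Rightarrow> 'a \<Rightarrow> 'a set" where
  "up_section A x = {y. x \<preceq>\<^bsub>A\<^esub> y}"

definition has_lower_bound :: "('a, 'm) imp_alg_scheme \<Rightarrow> 'a set \<Rightarrow> bool" where
  "has_lower_bound A X \<longleftrightarrow> (\<exists>z. \<forall>x\<in>X. z \<preceq>\<^bsub>A\<^esub> x)"

locale join_semilattice_top =
  fixes A :: "('a, 'm) imp_alg_scheme" (structure)
  assumes semilattice: "semilattice (\<squnion>)"
    and top: "x \<preceq> \<I>"

record 'a sec_alg = "'a imp_alg" +
  sprod :: "'a \<Rightarrow> 'a \<Rightarrow> 'a \<Rightarrow> 'a option"

record 'a rel_alg = "'a imp_alg" +
  rprod :: "'a \<Rightarrow> 'a \<Rightarrow> 'a option"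

definition section_monoid :: "'a sec_alg \<Rightarrow> 'a \<Rightarrow> 'a monoid" where
  "section_monoid S x =
     \<lparr>carrier = up_section S x, mult = (\<lambda>a b. the (sprod S x a b)), one = unity S\<rparr>"

locale sectionally_residuated = join_semilattice_top S
  for S :: "'a sec_alg" (structure) +
  assumes sprod_domain:
      "sprod S x a b \<noteq> None \<longleftrightarrow> a \<in> up_section S x \<and> b \<in> up_section S x"
    and sprod_monoid: "comm_monoid (section_monoid S x)"
    and sprod_coherent:
      "\<lbrakk>z \<preceq> u; u \<preceq> x; u \<preceq> y\<rbrakk> \<Longrightarrow> the (sprod S z x y) = the (sprod S u x y)"
    and sprod_mono:
      "\<lbrakk>u \<preceq> x; u \<preceq> y; u \<preceq> z; x \<preceq> y\<rbrakk> \<Longrightarrow> the (sprod S u x z) \<preceq> the (sprod S u y z)"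
    and sprod_residuated:
      "the (sprod S z (x \<squnion> z) (y \<squnion> z)) \<preceq> z \<longleftrightarrow> x \<squnion> z \<preceq> y \<rightarrow> z"
    and imp_vee: "(x \<squnion> y) \<rightarrow> y = x \<rightarrow> y"

text \<open>In associativity, both sides are defined because the product of two elements lies above
  all their common lower bounds.\<close>

locale relatively_residuated = join_semilattice_top R
  for R :: "'a rel_alg" (structure) +
  assumes rprod_domain: "rprod R x y \<noteq> None \<longleftrightarrow> has_lower_bound R {x, y}"
    and rprod_lower: "\<lbrakk>z \<preceq> x; z \<preceq> y\<rbrakk> \<Longrightarrow> z \<preceq> the (rprod R x y)"
    and rprod_unity: "rprod R x \<I> = Some x" "rprod R \<I> x = Some x"
    and rprod_commute: "has_lower_bound R {x, y} \<Longrightarrow> rprod R x y = rprod R y x"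
    and rprod_assoc: "has_lower_bound R {x, y, z} \<Longrightarrow>
      Option.bind (rprod R x y) (\<lambda>a. rprod R a z) = Option.bind (rprod R y z) (\<lambda>b. rprod R x b)"
    and rprod_mono: "\<lbrakk>x \<preceq> y; has_lower_bound R {x, z}\<rbrakk> \<Longrightarrow>
      the (rprod R x z) \<preceq> the (rprod R y z)"
    and rprod_residuated:
      "the (rprod R (x \<squnion> z) (y \<squnion> z)) \<preceq> z \<longleftrightarrow> x \<squnion> z \<preceq> y \<rightarrow> z"
    and imp_vee: "(x \<squnion> y) \<rightarrow> y = x \<rightarrow> y"

definition to_rel :: "'a sec_alg \<Rightarrow> 'a rel_alg" where
  "to_rel S =
     \<lparr>vee = vee S, imp = imp S, unity = unity S,
      rprod = (\<lambda>x y. if has_lower_bound S {x, y}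
                     then sprod S (SOME z. z \<preceq>\<^bsub>S\<^esub> x \<and> z \<preceq>\<^bsub>S\<^esub> y) x y else None)\<rparr>"

definition to_sec :: "'a rel_alg \<Rightarrow> 'a sec_alg" where
  "to_sec R =
     \<lparr>vee = vee R, imp = imp R, unity = unity R,
      sprod = (\<lambda>x a b. if a \<in> up_section R x \<and> b \<in> up_section R x then rprod R a b else None)\<rparr>"

text \<open>The lower bound chosen in \<^const>\<open>to_rel\<close> is immaterial.\<close>

lemma (in sectionally_residuated) rprod_to_rel:
  assumes "z \<preceq> x" "z \<preceq> y"
  shows "rprod (to_rel S) x y = sprod S z x y"
proof -
  interpret J: semilattice "(\<squnion>)" by (rule semilattice)
  define w where "w = (SOME z. z \<preceq> x \<and> z \<preceq> y)"
  have w: "w \<preceq> x" "w \<preceq> y"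
    using someI[of "\<lambda>z. z \<preceq> x \<and> z \<preceq> y" z] assms by (auto simp: w_def)
  have ub: "z \<preceq> z \<squnion> w" "w \<preceq> z \<squnion> w"
    by (metis leq_def J.left_idem, metis leq_def J.commute J.left_idem)
  have lb: "z \<squnion> w \<preceq> x" "z \<squnion> w \<preceq> y"
    using assms w by (auto simp: leq_def J.assoc)
  have "the (sprod S w x y) = the (sprod S z x y)"
    using sprod_coherent[OF ub(1) lb] sprod_coherent[OF ub(2) lb] by simp
  moreover have "sprod S w x y \<noteq> None" "sprod S z x y \<noteq> None"
    using assms w by (simp_all only: sprod_domain) (simp_all add: up_section_def)
  ultimately have "sprod S w x y = sprod S z x y"
    by (metis option.expand)
  moreover have "has_lower_bound S {x, y}"
    using assms by (auto simp: has_lower_bound_def)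
  ultimately show ?thesis
    by (simp add: to_rel_def w_def)
qed

end

theory Submission
  imports Defs
begin

text \<open>Coherence of the section products is what allows gluing. If \<open>z\<close> and
  \<open>w\<close> are both below \<open>x\<close> and \<open>y\<close>, then so is their join, and
  comparing each of the two section products with the one above the join shows that they agree on
  \<open>x\<close> and \<open>y\<close>. This is \<open>rprod_to_rel\<close>: the glued product may
  be computed in any section containing both factors. Each law of a relatively residuated
  semilattice concerns finitely many elements with a common lower bound, so it is checked inside one
  section monoid. Conversely, a global product lies above every common lower bound of its factors,
  so it restricts to each section, and the restrictions are coherent because they come from one
  operation. Neither translation alters join, implication or top, so the round trips only have to
  recover the products together with their domains.\<close>

context join_semilattice_top
begin

lemma leq_trans: "\<lbrakk>x \<preceq> y; y \<preceq> z\<rbrakk> \<Longrightarrow> x \<preceq> z"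
  unfolding leq_def using semilattice.axioms(1)[OF semilattice]
  by (metis abel_semigroup.axioms(1) semigroup.assoc)

lemma leq_refl: "x \<preceq> x"
  unfolding leq_def by (rule semilattice.idem[OF semilattice])

lemma leq_vee_right: "y \<preceq> x \<squnion> y"
proof -
  interpret J: semilattice "(\<squnion>)" by (rule semilattice)
  show ?thesis by (simp add: leq_def J.left_commute)
qed

end

lemma to_rel_simps [simp]:
  "vee (to_rel S) = vee S" "imp (to_rel S) = imp S" "unity (to_rel S) = unity S"
  by (simp_all add: to_rel_def)

lemma to_sec_simps [simp]:
  "vee (to_sec R) = vee R" "imp (to_sec R) = imp R" "unity (to_sec R) = unity R"
  by (simp_all add: to_sec_def)

text \<open>The order depends on the join alone, so both translations preserve it, and with it
  sections and lower bounds. Axioms of a translated algebra can therefore be read in the original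
  one.\<close>

lemma leq_to_rel [simp]: "leq (to_rel S) = leq S"
  and leq_to_sec [simp]: "leq (to_sec R) = leq R"
  by (simp_all add: fun_eq_iff leq_def)

lemma up_section_to_sec [simp]: "up_section (to_sec R) = up_section R"
  by (simp add: fun_eq_iff up_section_def)

lemma has_lower_bound_to_rel [simp]: "has_lower_bound (to_rel S) = has_lower_bound S"
  and has_lower_bound_to_sec [simp]: "has_lower_bound (to_sec R) = has_lower_bound R"
  by (simp_all add: fun_eq_iff has_lower_bound_def)

lemma sprod_to_sec:
  "sprod (to_sec R) x a b =
     (if x \<preceq>\<^bsub>R\<^esub> a \<and> x \<preceq>\<^bsub>R\<^esub> b then rprod R a b else None)"
  by (simp add: to_sec_def up_section_def)

context sectionally_residuated
begin

lemma sprod_eq_Some: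
  assumes "x \<preceq> a" "x \<preceq> b"
  shows "sprod S x a b = Some (the (sprod S x a b))"
  using assms sprod_domain[of x a b] by (auto simp: up_section_def)

lemma sprod_eq_None: "\<not> (x \<preceq> a \<and> x \<preceq> b) \<Longrightarrow> sprod S x a b = None"
  using sprod_domain[of x a b] by (auto simp: up_section_def)

text \<open>Closure of the section monoid becomes, after gluing, the requirement that a product lies
  above all common lower bounds of its factors.\<close>

lemma sprod_closed:
  assumes "x \<preceq> a" "x \<preceq> b"
  shows "x \<preceq> the (sprod S x a b)"
  using assms comm_monoid.axioms(1)[OF sprod_monoid, THEN monoid.m_closed, of a x b]
  by (simp add: section_monoid_def up_section_def)

lemma sprod_comm:
  assumes "x \<preceq> a" "x \<preceq> b"
  shows "sprod S x a b = sprod S x b a"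
proof -
  have "the (sprod S x a b) = the (sprod S x b a)"
    using assms comm_monoid.m_comm[OF sprod_monoid, of a x b]
    by (simp add: section_monoid_def up_section_def)
  then show ?thesis using assms sprod_eq_Some by metis
qed

lemma sprod_assoc:
  assumes "x \<preceq> a" "x \<preceq> b" "x \<preceq> c"
  shows "the (sprod S x (the (sprod S x a b)) c) = the (sprod S x a (the (sprod S x b c)))"
  using assms comm_monoid.axioms(1)[OF sprod_monoid, THEN monoid.m_assoc, of a x b c]
  by (simp add: section_monoid_def up_section_def)

lemma sprod_unity: "sprod S x x \<I> = Some x"
proof -
  have "the (sprod S x x \<I>) = x"
    using leq_refl comm_monoid.axioms(1)[OF sprod_monoid, THEN monoid.r_one, of x x]
    by (simp add: section_monoid_def up_section_def)
  then show ?thesis using sprod_eq_Some leq_refl top by metis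
qed

lemma relatively_residuated_to_rel: "relatively_residuated (to_rel S)"
proof (intro relatively_residuated.intro join_semilattice_top.intro relatively_residuated_axioms.intro,
    unfold to_rel_simps leq_to_rel has_lower_bound_to_rel)
  show "semilattice (\<squnion>)" "x \<preceq> \<I>" for x by (rule semilattice, rule top)
  show dom: "rprod (to_rel S) x y \<noteq> None \<longleftrightarrow> has_lower_bound S {x, y}" for x y
  proof
    assume "has_lower_bound S {x, y}"
    then obtain z where "z \<preceq> x" "z \<preceq> y" by (auto simp: has_lower_bound_def)
    then show "rprod (to_rel S) x y \<noteq> None"
      using sprod_eq_Some rprod_to_rel by (metis option.distinct(1))
  qed (simp add: to_rel_def split: if_splits)
  show "z \<preceq> the (rprod (to_rel S) x y)" if "z \<preceq> x" "z \<preceq> y" for x y z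
    using that sprod_closed rprod_to_rel by simp
  show "rprod (to_rel S) x \<I> = Some x" for x
    using rprod_to_rel[OF leq_refl top] sprod_unity by simp
  show "rprod (to_rel S) \<I> x = Some x" for x
    using rprod_to_rel[OF top leq_refl] sprod_unity sprod_comm[OF leq_refl top] by simp
  show "rprod (to_rel S) x y = rprod (to_rel S) y x" if lb: "has_lower_bound S {x, y}" for x y
  proof -
    obtain z where "z \<preceq> x" "z \<preceq> y" using lb by (auto simp: has_lower_bound_def)
    then show ?thesis by (simp add: rprod_to_rel[of z] sprod_comm)
  qed
  show "Option.bind (rprod (to_rel S) x y) (\<lambda>a. rprod (to_rel S) a z) =
      Option.bind (rprod (to_rel S) y z) (\<lambda>b. rprod (to_rel S) x b)"
    if lb: "has_lower_bound S {x, y, z}" for x y z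
  proof -
    \<comment> \<open>A single \<open>w\<close> below all three elements puts every product into the
      same monoid. By closure the inner products \<open>a\<close> and \<open>b\<close> stay above
      \<open>w\<close>, so the outer products can be computed there too.\<close>
    obtain w where w: "w \<preceq> x" "w \<preceq> y" "w \<preceq> z"
      using lb by (auto simp: has_lower_bound_def)
    obtain a b where ab: "sprod S w x y = Some a" "sprod S w y z = Some b"
      using w sprod_eq_Some by blast
    have "w \<preceq> a" "w \<preceq> b" using sprod_closed[of w x y] sprod_closed[of w y z] w ab by auto
    moreover have "the (sprod S w a z) = the (sprod S w x b)"
      using sprod_assoc[OF w] ab by simp
    ultimately show ?thesis
      using w ab sprod_eq_Some[of w a z] sprod_eq_Some[of w x b] by (simp add: rprod_to_rel[of w])
  qed
  show "the (rprod (to_rel S) x z) \<preceq> the (rprod (to_rel S) y z)"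
    if xy: "x \<preceq> y" and lb: "has_lower_bound S {x, z}" for x y z
  proof -
    obtain w where w: "w \<preceq> x" "w \<preceq> z" using lb by (auto simp: has_lower_bound_def)
    moreover have "w \<preceq> y" using w(1) xy by (rule leq_trans)
    ultimately show ?thesis using xy sprod_mono by (simp add: rprod_to_rel[of w])
  qed
  show "the (rprod (to_rel S) (x \<squnion> z) (y \<squnion> z)) \<preceq> z \<longleftrightarrow> x \<squnion> z \<preceq> y \<rightarrow> z" for x y z
    \<comment> \<open>The element \<open>z\<close> is itself a lower bound of both joins, so the
      glued product here is exactly the one in the section of \<open>z\<close>.\<close>
    using sprod_residuated by (simp add: rprod_to_rel[OF leq_vee_right leq_vee_right])
  show "(x \<squnion> y) \<rightarrow> y = x \<rightarrow> y" for x y by (rule imp_vee)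
qed

text \<open>For factors in the section of \<open>x\<close>, the element \<open>x\<close> is an
  admissible lower bound, so gluing and restricting returns \<open>sprod S x\<close>; for other
  factors both sides are \<open>None\<close>.\<close>

lemma to_sec_to_rel: "to_sec (to_rel S) = S"
proof (rule sec_alg.equality)
  show "sprod (to_sec (to_rel S)) = sprod S"
    by (intro ext) (auto simp: sprod_to_sec rprod_to_rel sprod_eq_None)
qed simp_all

end

context relatively_residuated
begin

lemma rprod_eq_Some:
  assumes "z \<preceq> x" "z \<preceq> y"
  shows "rprod R x y = Some (the (rprod R x y))"
  using assms rprod_domain[of x y] by (auto simp: has_lower_bound_def)

lemma the_rprod_commute: "\<lbrakk>z \<preceq> x; z \<preceq> y\<rbrakk> \<Longrightarrow> the (rprod R x y) = the (rprod R y x)"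
  by (rule arg_cong[OF rprod_commute]) (auto simp: has_lower_bound_def)

text \<open>The common lower bound makes both inner products defined, so the binds in
  \<open>rprod_assoc\<close> reduce to plain products, the form needed for the monoid law.\<close>

lemma the_rprod_assoc:
  assumes "w \<preceq> x" "w \<preceq> y" "w \<preceq> z"
  shows "the (rprod R (the (rprod R x y)) z) = the (rprod R x (the (rprod R y z)))"
proof -
  have "has_lower_bound R {x, y, z}" using assms by (auto simp: has_lower_bound_def)
  moreover obtain a b where "rprod R x y = Some a" "rprod R y z = Some b"
    using assms rprod_eq_Some by blast
  ultimately show ?thesis using rprod_assoc[of x y z] by simp
qed

lemma sectionally_residuated_to_sec: "sectionally_residuated (to_sec R)"
proof (intro sectionally_residuated.intro join_semilattice_top.intro sectionally_residuated_axioms.intro,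
    unfold to_sec_simps leq_to_sec up_section_to_sec)
  show "semilattice (\<squnion>)" "x \<preceq> \<I>" for x by (rule semilattice, rule top)
  show "sprod (to_sec R) x a b \<noteq> None \<longleftrightarrow> a \<in> up_section R x \<and> b \<in> up_section R x" for x a b
    using rprod_eq_Some[of x a b] by (auto simp: sprod_to_sec up_section_def)
  show "comm_monoid (section_monoid (to_sec R) x)" for x
    \<comment> \<open>The base point \<open>x\<close> serves as the common lower bound throughout;
      \<open>rprod_lower\<close> gives closure and keeps the inner products of the associative law
      in the section.\<close>
    by (rule comm_monoidI)
      (auto simp: section_monoid_def up_section_def sprod_to_sec rprod_unity top rprod_lower
        the_rprod_assoc[of x] intro: the_rprod_commute)
  show "the (sprod (to_sec R) z x y) = the (sprod (to_sec R) u x y)"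
    if "z \<preceq> u" "u \<preceq> x" "u \<preceq> y" for z u x y
    \<comment> \<open>By transitivity both factors also lie in the section of \<open>z\<close>, so
      both sides unfold to the same \<open>rprod R x y\<close>.\<close>
    using that leq_trans[of z u] by (simp add: sprod_to_sec)
  show "the (sprod (to_sec R) u x z) \<preceq> the (sprod (to_sec R) u y z)"
    if "u \<preceq> x" "u \<preceq> y" "u \<preceq> z" "x \<preceq> y" for u x y z
    using that rprod_mono[of x y z] by (auto simp: sprod_to_sec has_lower_bound_def)
  show "the (sprod (to_sec R) z (x \<squnion> z) (y \<squnion> z)) \<preceq> z \<longleftrightarrow> x \<squnion> z \<preceq> y \<rightarrow> z" for x y z
    using rprod_residuated by (simp add: sprod_to_sec leq_vee_right)
  show "(x \<squnion> y) \<rightarrow> y = x \<rightarrow> y" for x y by (rule imp_vee)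
qed

lemma to_rel_to_sec: "to_rel (to_sec R) = R"
proof (rule rel_alg.equality)
  \<comment> \<open>Since the restricted algebra is sectionally residuated, the lower bound chosen
    in \<open>to_rel\<close> can be replaced by any known one.\<close>
  interpret S: sectionally_residuated "to_sec R" by (rule sectionally_residuated_to_sec)
  show "rprod (to_rel (to_sec R)) = rprod R"
  proof (intro ext)
    fix x y
    show "rprod (to_rel (to_sec R)) x y = rprod R x y"
    proof (cases "has_lower_bound R {x, y}")
      case True
      then obtain z where "z \<preceq> x" "z \<preceq> y" by (auto simp: has_lower_bound_def)
      then show ?thesis by (simp add: S.rprod_to_rel[of z] sprod_to_sec)
    next
      case False
      then show ?thesis using rprod_domain[of x y] by (simp add: to_rel_def)
    qed
  qed
qed simp_all

end

theorem theorem4p6: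
  shows "(\<forall>S :: 'a sec_alg. sectionally_residuated S \<longrightarrow>
            relatively_residuated (to_rel S) \<and> to_sec (to_rel S) = S) \<and>
         (\<forall>R :: 'a rel_alg. relatively_residuated R \<longrightarrow>
            sectionally_residuated (to_sec R) \<and> to_rel (to_sec R) = R)"
  using sectionally_residuated.relatively_residuated_to_rel sectionally_residuated.to_sec_to_rel
    relatively_residuated.sectionally_residuated_to_sec relatively_residuated.to_rel_to_sec
  by blast

end
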